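(* Let $\mathbf{x}$ be a sample value of $\mathbf{X}$. Assume that: (A2) the joint (resp. marginal) CDF is continuous and has a density function $\rho>0$ on its open support; (A5) the function $f:\mathbb{R}^d\to\mathbb{R}$ is twice (formally) differentiable with respect to each input; (A6) every dependency function $r_{\pi_{i,k}}$ ($k=2,\dots,K$, $i=1,\dots,d_k$) is twice differentiable with respect to $X_{\pi_{i,k}}$. Then the matrix $\frac{\partial^2 f}{\partial^2\mathbf{x}}(\mathbf{x})$ of dependent second-order partial derivatives of $f$ is the $K\times K$ block matrix whose block $(k_1,k_2)$ (rows indexed by $\boldsymbol{\pi}_{k_1}$, columns by $\boldsymbol{\pi}_{k_2}$) is: - $H_{\boldsymbol{\pi}_1}(\mathbf{x})$ if $k_1=k_2=1$; - $H_{\boldsymbol{\pi}_1,\boldsymbol{\pi}_{k}}(\mathbf{x})\,J^d_{\boldsymbol{\pi}_{k}}(\mathbf{x}_{\boldsymbol{\pi}_{k}})$ if $k_1=1$, $k_2=k\ge2$; - $J^d_{\boldsymbol{\pi}_{k}}(\mathbf{x}_{\boldsymbol{\pi}_{k}})^{T}H_{\boldsymbol{\pi}_{k},\boldsymbol{\pi}_1}(\mathbf{x})$ if $k_1=k\ge2$, $k_2=1$; - $J^d_{\boldsymbol{\pi}_{k_1}}(\mathbf{x}_{\boldsymbol{\pi}_{k_1}})^{T}H_{\boldsymbol{\pi}_{k_1},\boldsymbol{\pi}_{k_2}}(\mathbf{x})\,J^d_{\boldsymbol{\pi}_{k_2}}(\mathbf{x}_{\boldsymbol{\pi}_{k_2}})$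 if $k_1,k_2\ge2$, $k_1\ne k_2$; - $J^d_{\boldsymbol{\pi}_k}(\mathbf{x}_{\boldsymbol{\pi}_k})^{T}H_{\boldsymbol{\pi}_k}(\mathbf{x})\,J^d_{\boldsymbol{\pi}_k}(\mathbf{x}_{\boldsymbol{\pi}_k})+\mathcal{D}J^d_{\boldsymbol{\pi}_k}(\mathbf{x})$ if $k_1=k_2=k\ge2$.
   Context: $\mathbf{X}=(X_1,\dots,X_d)$ is a random vector of continuous variables with joint CDF $F$, made of independent blocks $\mathbf{X}_{\boldsymbol{\pi}_1},\dots,\mathbf{X}_{\boldsymbol{\pi}_K}$, where $\boldsymbol{\pi}_1,\dots,\boldsymbol{\pi}_K$ is a partition of $\{1,\dots,d\}$, $\mathbf{X}_{\boldsymbol{\pi}_k}=(X_i)_{i\in\boldsymbol{\pi}_k}$ and $d_k=|\boldsymbol{\pi}_k|$. The block $\mathbf{X}_{\boldsymbol{\pi}_1}$ consists of $d_1\ge 0$ independent variables; for $k\ge 2$ the block $\mathbf{X}_{\boldsymbol{\pi}_k}$ consists of $d_k\ge2$ dependent variables. Write $\boldsymbol{\pi}_k=\{\pi_{1,k}<\dots<\pi_{d_k,k}\}$ and $(\sim\pi_{i,k})=(\pi_{1,k},\dots,\pi_{i-1,k},\pi_{i+1,k},\dots,\pi_{d_k,k})$. Coordinates are ordered block by block. For each $k\ge2$ and each $i=1,\dots,d_k$ one uses the dependency model with explanatory variable $X_{\pi_{i,k}}$: $\mathbf{X}_{\sim\pi_{i,k}}=r_{\pi_{i,k}}(X_{\pi_{i,k}},\mathbf{Z}_{\pi_{i,k}})$,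 where $\mathbf{Z}_{\pi_{i,k}}$ is a vector of $d_k-1$ independent variables, independent of $X_{\pi_{i,k}}$. In this model the component giving $X_{\pi_{\ell,k}}$ ($\ell\ne i$) is written $r_{\pi_{\ell,k}}$. For given $x_{\pi_{i,k}}$ the map $\mathbf{z}\mapsto r_{\pi_{i,k}}(x_{\pi_{i,k}},\mathbf{z})$ has a unique inverse $r_{\pi_{i,k}}^{-1}(\cdot\mid x_{\pi_{i,k}})$. Define the column vectors (derivatives taken with $\mathbf{Z}_{\pi_{i,k}}$ held fixed) $$J^{(\pi_{i,k})}(\mathbf{x}_{\boldsymbol{\pi}_k})=\frac{\partial\mathbf{X}_{\boldsymbol{\pi}_k}}{\partial x_{\pi_{i,k}}}=\left[\frac{\partial r_{\pi_{1,k}}}{\partial x_{\pi_{i,k}}}\cdots\underbrace{1}_{i\text{th}}\cdots\frac{\partial r_{\pi_{d_k,k}}}{\partial x_{\pi_{i,k}}}\right]^{T}\left(x_{\pi_{i,k}},r_{\pi_{i,k}}^{-1}(\mathbf{x}_{\sim\pi_{i,k}}\mid x_{\pi_{i,k}})\right),$$ $$\frac{\partial J^{(\pi_{i,k})}}{\partial x_{\pi_{i,k}}}(\mathbf{x}_{\boldsymbol{\pi}_k})=\left[\frac{\partial^2 r_{\pi_{1,k}}}{\partial^2 x_{\pi_{i,k}}}\cdots\underbrace{0}_{i\text{th}}\cdots\frac{\partial^2 r_{\pi_{d_k,k}}}{\partial^2 x_{\pi_{i,k}}}\right]^{T}\left(x_{\pi_{i,k}},r_{\pi_{i,k}}^{-1}(\mathbf{x}_{\sim\pi_{i,k}}\mid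 x_{\pi_{i,k}})\right),$$ and the dependent Jacobian matrices $J^d_{\boldsymbol{\pi}_k}(\mathbf{x}_{\boldsymbol{\pi}_k})=[J^{(\pi_{1,k})}(\mathbf{x}_{\boldsymbol{\pi}_k})\ \cdots\ J^{(\pi_{d_k,k})}(\mathbf{x}_{\boldsymbol{\pi}_k})]$, $k\ge2$, and $J^d(\mathbf{x})=\mathrm{blockdiag}(\mathcal{I}_{d_1\times d_1},J^d_{\boldsymbol{\pi}_2}(\mathbf{x}_{\boldsymbol{\pi}_2}),\dots,J^d_{\boldsymbol{\pi}_K}(\mathbf{x}_{\boldsymbol{\pi}_K}))$. Let $J^{(\pi_{\ell,k})}_i$ be the $i$-th component of $J^{(\pi_{\ell,k})}$. Formal derivatives of $f$ are ordinary partial derivatives with the other inputs held constant: $\nabla f_{\mathbf{x}_{\boldsymbol{\pi}_k}}$ is the vector of $f'_{x_p}$, $p\in\boldsymbol{\pi}_k$; $\nabla f$ is the concatenation of these over $k$; $H_{\boldsymbol{\pi}_k}=(f''_{x_{p}x_{q}})_{p,q\in\boldsymbol{\pi}_k}$; $H_{\boldsymbol{\pi}_{k_1},\boldsymbol{\pi}_{k_2}}=(f''_{x_px_q})_{p\in\boldsymbol{\pi}_{k_1},q\in\boldsymbol{\pi}_{k_2}}$ for $k_1\neq k_2$, where $f''_{x_px_q}$ is the formal derivative of $f'_{x_p}$ with respect to $x_q$. For $k\ge2$, $$\mathcal{D}J^d_{\boldsymbol{\pi}_k}(\mathbf{x})=\mathrm{diag}\left(\left[\frac{\partial J^{(\pi_{1,k})}}{\partial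 x_{\pi_{1,k}}}(\mathbf{x}_{\boldsymbol{\pi}_k}),\dots,\frac{\partial J^{(\pi_{d_k,k})}}{\partial x_{\pi_{d_k,k}}}(\mathbf{x}_{\boldsymbol{\pi}_k})\right]^{T}\nabla f_{\mathbf{x}_{\boldsymbol{\pi}_k}}(\mathbf{x})\right)J^d_{\boldsymbol{\pi}_k}(\mathbf{x}_{\boldsymbol{\pi}_k}),$$ where $\mathrm{diag}(v)$ is the diagonal matrix with diagonal $v$. The dependent first-order partial derivatives of $f$ are $\frac{\partial f}{\partial\mathbf{x}}(\mathbf{x})=J^d(\mathbf{x})^{T}\nabla f(\mathbf{x})$. The dependent second-order partial derivative in position $(p,q)$ is the dependent derivative with respect to $x_q$ of $\frac{\partial f}{\partial x_p}$, computed by the product rule with the following chain rules: the dependent derivative of $f'_{x_p}$ with respect to $x_q$ is $\sum_{s=1}^d f''_{x_px_s}(\mathbf{x})\,J^d_{sq}(\mathbf{x})$; the dependent derivative of $J^{(\pi_{i,k})}$ with respect to $x_{\pi_{\ell,k}}$ is $\frac{\partial x_{\pi_{i,k}}}{\partial x_{\pi_{\ell,k}}}\frac{\partial J^{(\pi_{i,k})}}{\partial x_{\pi_{i,k}}}=J^{(\pi_{\ell,k})}_i\,\frac{\partial J^{(\pi_{i,k})}}{\partial x_{\pi_{i,k}}}$; and the dependent derivative of $J^{(\pi_{i,k})}$ with respect to a variable of a block other than $k$ is zero. *)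

theory Defs
  imports "HOL-Probability.Probability" "Jordan_Normal_Form.Matrix"
begin

unbundle no vec_syntax

text \<open>
  Points of \<open>\<real>\<^sup>d\<close> are extensional functions on \<open>{1..d}\<close>, and a subvector with index set
  \<open>P\<close> is \<open>restrict x P\<close>. Blocks are numbered \<open>1, \<dots>, K\<close>, with \<open>\<pi> k\<close> the index set of block
  \<open>k\<close>. Coordinates keep their labels \<open>1, \<dots>, d\<close>, whereas vector and matrix positions are counted
  from 0: position \<open>i\<close> of block \<open>k\<close> carries the label \<open>block_coords \<pi> k ! i\<close>.
\<close>

text \<open>
  \<open>r p t z\<close> is the dependency function with explanatory variable \<open>X\<^sub>p\<close>, evaluated at \<open>X\<^sub>p = t\<close> and
  \<open>Z\<^sub>p = z\<close>; the value \<open>r p t z\<close> and the argument \<open>z\<close> are both indexed by the remaining labels of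
  the block of \<open>p\<close>. The attained values \<open>X\<^sub>p ` \<Omega>\<close> and \<open>Z\<^sub>p ` \<Omega>\<close> serve as the domain of \<open>r p\<close>:
  invertibility in \<open>z\<close> is required there only, since for example a quantile
  transformation is not injective (or not meaningful) outside the range of a uniform variable.
  The variable \<open>X\<^sub>p\<close> enters \<open>Z_indep_X\<close> as a subvector of length one, because \<open>indep_var\<close> needs
  both random variables to be of the same type.
\<close>

locale dependency_model = prob_space M
  for M :: "'a measure" and d K :: nat and \<pi> :: "nat \<Rightarrow> nat set"
    and X :: "'a \<Rightarrow> nat \<Rightarrow> real" and Z :: "nat \<Rightarrow> 'a \<Rightarrow> nat \<Rightarrow> real"
    and r :: "nat \<Rightarrow> real \<Rightarrow> (nat \<Rightarrow> real) \<Rightarrow> nat \<Rightarrow> real" +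
  assumes K_pos: "1 \<le> K"
    and blocks_cover: "(\<Union>k\<in>{1..K}. \<pi> k) = {1..d}"
    and blocks_disjoint: "disjoint_family_on \<pi> {1..K}"
    and card_block: "\<And>k. k \<in> {2..K} \<Longrightarrow> 2 \<le> card (\<pi> k)"
    and X_measurable: "X \<in> M \<rightarrow>\<^sub>M (\<Pi>\<^sub>M i\<in>{1..d}. borel)"
    and blocks_indep:
      "indep_vars (\<lambda>k. \<Pi>\<^sub>M i\<in>\<pi> k. borel) (\<lambda>k \<omega>. restrict (X \<omega>) (\<pi> k)) {1..K}"
    and first_block_indep: "indep_vars (\<lambda>_. borel) (\<lambda>i \<omega>. X \<omega> i) (\<pi> 1)"
    and other_blocks_dependent:
      "\<And>k. k \<in> {2..K} \<Longrightarrow> \<not> indep_vars (\<lambda>_. borel) (\<lambda>i \<omega>. X \<omega> i) (\<pi> k)"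
    and Z_indep:
      "\<And>k p. k \<in> {2..K} \<Longrightarrow> p \<in> \<pi> k \<Longrightarrow> indep_vars (\<lambda>_. borel) (\<lambda>j \<omega>. Z p \<omega> j) (\<pi> k - {p})"
    and Z_indep_X:
      "\<And>k p. k \<in> {2..K} \<Longrightarrow> p \<in> \<pi> k \<Longrightarrow>
         indep_var (\<Pi>\<^sub>M j\<in>{p}. borel) (\<lambda>\<omega>. restrict (X \<omega>) {p})
           (\<Pi>\<^sub>M j\<in>\<pi> k - {p}. borel) (Z p)"
    and dependency:
      "\<And>k p \<omega>. k \<in> {2..K} \<Longrightarrow> p \<in> \<pi> k \<Longrightarrow> \<omega> \<in> space M \<Longrightarrow>
         restrict (X \<omega>) (\<pi> k - {p}) = r p (X \<omega> p) (Z p \<omega>)"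
    and invertible:
      "\<And>k p t. k \<in> {2..K} \<Longrightarrow> p \<in> \<pi> k \<Longrightarrow> t \<in> (\<lambda>\<omega>. X \<omega> p) ` space M \<Longrightarrow>
         inj_on (r p t) (Z p ` space M)"

definition joint_cdf :: "'a measure \<Rightarrow> nat \<Rightarrow> ('a \<Rightarrow> nat \<Rightarrow> real) \<Rightarrow> (nat \<Rightarrow> real) \<Rightarrow> real" where
  "joint_cdf M d X x = measure M {\<omega> \<in> space M. \<forall>i\<in>{1..d}. X \<omega> i \<le> x i}"

definition positive_density_on_open_support ::
  "'b topology \<Rightarrow> 'b measure \<Rightarrow> 'a measure \<Rightarrow> ('a \<Rightarrow> 'b) \<Rightarrow> bool" where
  "positive_density_on_open_support T N M Y \<longleftrightarrow>
     (\<exists>(\<rho> :: 'b \<Rightarrow> real) S. openin T S \<and> (\<forall>y\<in>S. 0 < \<rho> y) \<and> (\<forall>y\<in>topspace T - S. \<rho> y = 0) \<and>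
        distributed M N Y (\<lambda>y. ennreal (\<rho> y)))"

definition partial_deriv :: "((nat \<Rightarrow> real) \<Rightarrow> real) \<Rightarrow> nat \<Rightarrow> (nat \<Rightarrow> real) \<Rightarrow> real" where
  "partial_deriv f p x = deriv (\<lambda>t. f (x(p := t))) (x p)"

definition partially_differentiable :: "nat \<Rightarrow> ((nat \<Rightarrow> real) \<Rightarrow> real) \<Rightarrow> bool" where
  "partially_differentiable d f \<longleftrightarrow>
     (\<forall>x\<in>({1..d} \<rightarrow>\<^sub>E UNIV). \<forall>p\<in>{1..d}. (\<lambda>t. f (x(p := t))) differentiable at (x p))"

definition twice_partially_differentiable :: "nat \<Rightarrow> ((nat \<Rightarrow> real) \<Rightarrow> real) \<Rightarrow> bool" where
  "twice_partially_differentiable d f \<longleftrightarrow>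
     partially_differentiable d f \<and>
     (\<forall>p\<in>{1..d}. partially_differentiable d (partial_deriv f p))"

definition twice_differentiable_at :: "(real \<Rightarrow> real) \<Rightarrow> real \<Rightarrow> bool" where
  "twice_differentiable_at g t \<longleftrightarrow>
     (\<forall>\<^sub>F s in nhds t. g differentiable at s) \<and> deriv g differentiable at t"

definition block_coords :: "(nat \<Rightarrow> nat set) \<Rightarrow> nat \<Rightarrow> nat list" where
  "block_coords \<pi> k = sorted_list_of_set (\<pi> k)"

definition all_coords :: "nat \<Rightarrow> (nat \<Rightarrow> nat set) \<Rightarrow> nat list" where
  "all_coords K \<pi> = concat (map (block_coords \<pi>) [1..<Suc K])"

definition block_offset :: "(nat \<Rightarrow> nat set) \<Rightarrow> nat \<Rightarrow> nat" where
  "block_offset \<pi> k = (\<Sum>j\<in>{1..<k}. card (\<pi> j))"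

definition mat_block :: "(nat \<Rightarrow> nat set) \<Rightarrow> real mat \<Rightarrow> nat \<Rightarrow> nat \<Rightarrow> real mat" where
  "mat_block \<pi> A k1 k2 =
     mat (card (\<pi> k1)) (card (\<pi> k2)) (\<lambda>(i, j). A $$ (block_offset \<pi> k1 + i, block_offset \<pi> k2 + j))"

definition gradient :: "((nat \<Rightarrow> real) \<Rightarrow> real) \<Rightarrow> nat list \<Rightarrow> (nat \<Rightarrow> real) \<Rightarrow> real vec" where
  "gradient f ps x = vec_of_list (map (\<lambda>p. partial_deriv f p x) ps)"

definition hessian ::
  "((nat \<Rightarrow> real) \<Rightarrow> real) \<Rightarrow> nat list \<Rightarrow> nat list \<Rightarrow> (nat \<Rightarrow> real) \<Rightarrow> real mat" where
  "hessian f ps qs x =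
     mat (length ps) (length qs) (\<lambda>(i, j). partial_deriv (partial_deriv f (ps ! i)) (qs ! j) x)"

text \<open>
  In the following, \<open>ps\<close> lists the labels of the block containing \<open>p\<close>.
\<close>

definition r_inv ::
  "'a measure \<Rightarrow> (nat \<Rightarrow> 'a \<Rightarrow> nat \<Rightarrow> real) \<Rightarrow> (nat \<Rightarrow> real \<Rightarrow> (nat \<Rightarrow> real) \<Rightarrow> nat \<Rightarrow> real) \<Rightarrow>
   nat \<Rightarrow> (nat \<Rightarrow> real) \<Rightarrow> real \<Rightarrow> nat \<Rightarrow> real" where
  "r_inv M Z r p y t = inv_into (Z p ` space M) (r p t) y"

definition jac_col ::
  "'a measure \<Rightarrow> (nat \<Rightarrow> 'a \<Rightarrow> nat \<Rightarrow> real) \<Rightarrow> (nat \<Rightarrow> real \<Rightarrow> (nat \<Rightarrow> real) \<Rightarrow> nat \<Rightarrow> real) \<Rightarrow>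
   nat list \<Rightarrow> nat \<Rightarrow> (nat \<Rightarrow> real) \<Rightarrow> real vec" where
  "jac_col M Z r ps p x =
     (let z = r_inv M Z r p (restrict x (set ps - {p})) (x p)
      in vec_of_list (map (\<lambda>j. if j = p then 1 else deriv (\<lambda>t. r p t z j) (x p)) ps))"

definition deriv_jac_col ::
  "'a measure \<Rightarrow> (nat \<Rightarrow> 'a \<Rightarrow> nat \<Rightarrow> real) \<Rightarrow> (nat \<Rightarrow> real \<Rightarrow> (nat \<Rightarrow> real) \<Rightarrow> nat \<Rightarrow> real) \<Rightarrow>
   nat list \<Rightarrow> nat \<Rightarrow> (nat \<Rightarrow> real) \<Rightarrow> real vec" where
  "deriv_jac_col M Z r ps p x =
     (let z = r_inv M Z r p (restrict x (set ps - {p})) (x p)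
      in vec_of_list (map (\<lambda>j. if j = p then 0 else deriv (deriv (\<lambda>t. r p t z j)) (x p)) ps))"

definition jac_block ::
  "'a measure \<Rightarrow> (nat \<Rightarrow> 'a \<Rightarrow> nat \<Rightarrow> real) \<Rightarrow> (nat \<Rightarrow> real \<Rightarrow> (nat \<Rightarrow> real) \<Rightarrow> nat \<Rightarrow> real) \<Rightarrow>
   nat list \<Rightarrow> (nat \<Rightarrow> real) \<Rightarrow> real mat" where
  "jac_block M Z r ps x = mat_of_cols (length ps) (map (\<lambda>p. jac_col M Z r ps p x) ps)"

definition jac ::
  "'a measure \<Rightarrow> nat \<Rightarrow> (nat \<Rightarrow> nat set) \<Rightarrow> (nat \<Rightarrow> 'a \<Rightarrow> nat \<Rightarrow> real) \<Rightarrow>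
   (nat \<Rightarrow> real \<Rightarrow> (nat \<Rightarrow> real) \<Rightarrow> nat \<Rightarrow> real) \<Rightarrow> (nat \<Rightarrow> real) \<Rightarrow> real mat" where
  "jac M K \<pi> Z r x =
     diag_block_mat (1\<^sub>m (card (\<pi> 1)) #
       map (\<lambda>k. jac_block M Z r (block_coords \<pi> k) x) [2..<Suc K])"

definition DJ_block ::
  "'a measure \<Rightarrow> (nat \<Rightarrow> 'a \<Rightarrow> nat \<Rightarrow> real) \<Rightarrow> (nat \<Rightarrow> real \<Rightarrow> (nat \<Rightarrow> real) \<Rightarrow> nat \<Rightarrow> real) \<Rightarrow>
   ((nat \<Rightarrow> real) \<Rightarrow> real) \<Rightarrow> nat list \<Rightarrow> (nat \<Rightarrow> real) \<Rightarrow> real mat" where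
  "DJ_block M Z r f ps x =
     (let v = transpose_mat (mat_of_cols (length ps) (map (\<lambda>p. deriv_jac_col M Z r ps p x) ps))
                *\<^sub>v gradient f ps x
      in mat_diag (length ps) (\<lambda>i. v $ i) * jac_block M Z r ps x)"

definition dep_gradient ::
  "'a measure \<Rightarrow> nat \<Rightarrow> (nat \<Rightarrow> nat set) \<Rightarrow> (nat \<Rightarrow> 'a \<Rightarrow> nat \<Rightarrow> real) \<Rightarrow>
   (nat \<Rightarrow> real \<Rightarrow> (nat \<Rightarrow> real) \<Rightarrow> nat \<Rightarrow> real) \<Rightarrow> ((nat \<Rightarrow> real) \<Rightarrow> real) \<Rightarrow> (nat \<Rightarrow> real) \<Rightarrow> real vec" where
  "dep_gradient M K \<pi> Z r f x = transpose_mat (jac M K \<pi> Z r x) *\<^sub>v gradient f (all_coords K \<pi>) x"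

lemma dim_jac:
  assumes "1 \<le> K"
  shows "dim_row (jac M K \<pi> Z r x) = length (all_coords K \<pi>)"
    and "dim_col (jac M K \<pi> Z r x) = length (all_coords K \<pi>)"
proof -
  have "[1..<Suc K] = 1 # [2..<Suc K]"
    using assms by (metis Suc_1 le_imp_less_Suc upt_conv_Cons)
  then show "dim_row (jac M K \<pi> Z r x) = length (all_coords K \<pi>)"
    and "dim_col (jac M K \<pi> Z r x) = length (all_coords K \<pi>)"
    by (simp_all add: jac_def dim_diag_block_mat all_coords_def length_concat comp_def
        jac_block_def block_coords_def del: upt_Suc)
qed

lemma dep_gradient_index:
  assumes "1 \<le> K" and "a < length (all_coords K \<pi>)"
  shows "dep_gradient M K \<pi> Z r f x $ a =
    (\<Sum>s<length (all_coords K \<pi>). jac M K \<pi> Z r x $$ (s, a) * gradient f (all_coords K \<pi>) x $ s)"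
proof -
  have "dim_vec (gradient f (all_coords K \<pi>) x) = length (all_coords K \<pi>)"
    by (simp add: gradient_def)
  then show ?thesis
    using assms by (simp add: dep_gradient_def scalar_prod_def dim_jac lessThan_atLeast0)
qed

text \<open>
  Entry \<open>s\<close> is the dependent derivative, with respect to the variable labelled \<open>q\<close>, of the formal
  derivative of \<open>f\<close> at position \<open>s\<close>; \<open>b\<close> is the position of \<open>q\<close>.
\<close>

definition dep_deriv_gradient ::
  "'a measure \<Rightarrow> nat \<Rightarrow> (nat \<Rightarrow> nat set) \<Rightarrow> (nat \<Rightarrow> 'a \<Rightarrow> nat \<Rightarrow> real) \<Rightarrow>
   (nat \<Rightarrow> real \<Rightarrow> (nat \<Rightarrow> real) \<Rightarrow> nat \<Rightarrow> real) \<Rightarrow> ((nat \<Rightarrow> real) \<Rightarrow> real) \<Rightarrow> nat \<Rightarrow> (nat \<Rightarrow> real) \<Rightarrow> real vec" where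
  "dep_deriv_gradient M K \<pi> Z r f b x =
     (let cs = all_coords K \<pi> in
      vec (length cs) (\<lambda>s. \<Sum>u<length cs. hessian f cs cs x $$ (s, u) * jac M K \<pi> Z r x $$ (u, b)))"

text \<open>
  Entrywise dependent derivative of the Jacobian with respect to the variable labelled \<open>q\<close>. The
  column \<open>J\<^bsup>(p)\<^esup>\<close>, with \<open>p\<close> at position \<open>i\<close> of its block, has derivative
  \<open>J\<^bsup>(q)\<^esup>\<^sub>i \<cdot> \<partial>J\<^bsup>(p)\<^esup>/\<partial>x\<^sub>p\<close> if \<open>q\<close> is in the same block and zero otherwise; the identity block and the
  off-diagonal zeros of the Jacobian are constant.
\<close>

definition dep_deriv_jac_block ::
  "'a measure \<Rightarrow> (nat \<Rightarrow> 'a \<Rightarrow> nat \<Rightarrow> real) \<Rightarrow> (nat \<Rightarrow> real \<Rightarrow> (nat \<Rightarrow> real) \<Rightarrow> nat \<Rightarrow> real) \<Rightarrow>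
   nat list \<Rightarrow> nat \<Rightarrow> (nat \<Rightarrow> real) \<Rightarrow> real mat" where
  "dep_deriv_jac_block M Z r ps q x =
     (if q \<in> set ps
      then mat_of_cols (length ps)
        (map (\<lambda>i. (jac_col M Z r ps q x $ i) \<cdot>\<^sub>v deriv_jac_col M Z r ps (ps ! i) x) [0..<length ps])
      else 0\<^sub>m (length ps) (length ps))"

definition dep_deriv_jac ::
  "'a measure \<Rightarrow> nat \<Rightarrow> (nat \<Rightarrow> nat set) \<Rightarrow> (nat \<Rightarrow> 'a \<Rightarrow> nat \<Rightarrow> real) \<Rightarrow>
   (nat \<Rightarrow> real \<Rightarrow> (nat \<Rightarrow> real) \<Rightarrow> nat \<Rightarrow> real) \<Rightarrow> nat \<Rightarrow> (nat \<Rightarrow> real) \<Rightarrow> real mat" where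
  "dep_deriv_jac M K \<pi> Z r q x =
     diag_block_mat (0\<^sub>m (card (\<pi> 1)) (card (\<pi> 1)) #
       map (\<lambda>k. dep_deriv_jac_block M Z r (block_coords \<pi> k) q x) [2..<Suc K])"

text \<open>
  Entry \<open>(a, b)\<close> is the product rule applied to component \<open>a\<close> of \<open>dep_gradient\<close>, in the
  form of \<open>dep_gradient_index\<close>.
\<close>

definition dep_hessian ::
  "'a measure \<Rightarrow> nat \<Rightarrow> (nat \<Rightarrow> nat set) \<Rightarrow> (nat \<Rightarrow> 'a \<Rightarrow> nat \<Rightarrow> real) \<Rightarrow>
   (nat \<Rightarrow> real \<Rightarrow> (nat \<Rightarrow> real) \<Rightarrow> nat \<Rightarrow> real) \<Rightarrow> ((nat \<Rightarrow> real) \<Rightarrow> real) \<Rightarrow> (nat \<Rightarrow> real) \<Rightarrow> real mat" where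
  "dep_hessian M K \<pi> Z r f x =
     (let cs = all_coords K \<pi>; n = length cs in
      mat n n (\<lambda>(a, b). \<Sum>s<n.
        dep_deriv_jac M K \<pi> Z r (cs ! b) x $$ (s, a) * gradient f cs x $ s +
        jac M K \<pi> Z r x $$ (s, a) * dep_deriv_gradient M K \<pi> Z r f b x $ s))"

end

theory Submission
  imports Defs
begin

text \<open>
  The Jacobian and its dependent derivative are block diagonal for the same partition, so every sum
  over all coordinates in the product rule collapses to a sum over a single block. In the entry
  \<open>(a, b)\<close> the two terms become \<open>J\<^sup>T H J\<close> and, because the derivative of column \<open>a\<close> is
  \<open>J\<^bsub>a b\<^esub>\<close> times the second-derivative vector \<open>\<partial>J\<^bsup>(a)\<^esup>/\<partial>x\<^sub>a\<close>, a row-scaled copy of \<open>J\<close>.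
\<close>

section \<open>Block offsets and the correspondence between positions and labels\<close>

lemma block_offset_Suc:
  assumes "1 \<le> k"
  shows "block_offset \<pi> (Suc k) = block_offset \<pi> k + card (\<pi> k)"
  using assms by (simp add: block_offset_def)

lemma block_offset_mono: "k \<le> l \<Longrightarrow> block_offset \<pi> k \<le> block_offset \<pi> l"
  unfolding block_offset_def by (rule sum_mono2) auto

text \<open>Block \<open>k\<close> ends where block \<open>Suc k\<close> starts, and offsets
  increase up to \<open>block_offset \<pi> (Suc K)\<close>, the total number of coordinates.\<close>

lemma block_index_less:
  assumes "k \<in> {1..K}" and "i < card (\<pi> k)"
  shows "block_offset \<pi> k + i < block_offset \<pi> (Suc K)"
  using assms block_offset_mono[of "Suc k" "Suc K" \<pi>] by (simp add: block_offset_Suc)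

text \<open>Infinite index sets are covered as well: their cardinality and the length of their
  sorted list are both 0 by default.\<close>

lemma length_block_coords [simp]: "length (block_coords \<pi> k) = card (\<pi> k)"
  by (simp add: block_coords_def)

lemma all_coords_Suc: "all_coords (Suc K) \<pi> = all_coords K \<pi> @ block_coords \<pi> (Suc K)"
  by (simp add: all_coords_def)

lemma length_all_coords [simp]: "length (all_coords K \<pi>) = block_offset \<pi> (Suc K)"
proof (induction K)
  case 0
  show ?case by (simp add: all_coords_def block_offset_def)
next
  case (Suc K)
  then show ?case by (simp add: all_coords_Suc block_offset_Suc[of "Suc K"])
qed

text \<open>Through this conversion of positions into labels, entries of the full gradient and
  Hessian become entries of the block versions.\<close>

lemma all_coords_nth:
  assumes "k \<in> {1..K}" and "i < card (\<pi> k)"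
  shows "all_coords K \<pi> ! (block_offset \<pi> k + i) = block_coords \<pi> k ! i"
  using assms
proof (induction K)
  case 0
  then show ?case by simp
next
  case (Suc K)
  show ?case
  proof (cases "k = Suc K")
    case True
    then show ?thesis by (simp add: all_coords_Suc nth_append)
  next
    case False
    with Suc have "k \<in> {1..K}" by auto
    with Suc block_index_less[of k K i \<pi>] show ?thesis
      by (simp add: all_coords_Suc nth_append)
  qed
qed

section \<open>Sums over blocks and block diagonal matrices\<close>

lemma sum_over_blocks:
  fixes g :: "nat \<Rightarrow> 'b :: comm_monoid_add"
  shows "(\<Sum>s<block_offset \<pi> (Suc K). g s) =
    (\<Sum>k\<in>{1..K}. \<Sum>i<card (\<pi> k). g (block_offset \<pi> k + i))"
proof (induction K)
  case 0
  show ?case by (simp add: block_offset_def)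
next
  case (Suc K)
  have "(\<Sum>s<a + b. g s) = (\<Sum>s<a. g s) + (\<Sum>i<b. g (a + i))" for a b
    by (induction b) (simp_all add: add.assoc)
  with Suc show ?case by (simp add: block_offset_Suc[of "Suc K"])
qed

text \<open>The recursion of \<open>diag_block_mat\<close> splits off the first block, whereas an
  offset counts the blocks before a given one. Induction on \<open>K\<close> needs the last block
  split off, which leaves all earlier positions unchanged.\<close>

lemma diag_block_mat_upt_Suc:
  "diag_block_mat (map B [1..<Suc (Suc K)]) =
    (let A = diag_block_mat (map B [1..<Suc K]); C = B (Suc K)
     in four_block_mat A (0\<^sub>m (dim_row A) (dim_col C)) (0\<^sub>m (dim_row C) (dim_col A)) C)"
proof -
  have "map B [1..<Suc (Suc K)] = map B [1..<Suc K] @ [B (Suc K)]" by simp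
  then show ?thesis by (simp only: diag_block_mat_last Let_def)
qed

text \<open>\<open>jac\<close> and \<open>dep_deriv_jac\<close> list the first block separately.
  Absorbing it into a single family lets the general facts on block diagonal matrices treat all
  blocks alike.\<close>

lemma diag_block_mat_upt_first:
  assumes "1 \<le> K"
  shows "diag_block_mat (A # map B [2..<Suc K]) =
    diag_block_mat (map (\<lambda>k. if k = 1 then A else B k) [1..<Suc K])"
proof -
  have "[1..<Suc K] = 1 # [2..<Suc K]"
    using assms by (metis Suc_1 le_imp_less_Suc upt_conv_Cons)
  then have "map (\<lambda>k. if k = 1 then A else B k) [1..<Suc K] = A # map B [2..<Suc K]"
    by (auto simp del: upt_Suc)
  then show ?thesis by (simp only:)
qed

lemma dim_diag_block_mat_blocks:
  fixes B :: "nat \<Rightarrow> 'b :: zero mat"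
  assumes "\<And>k. k \<in> {1..K} \<Longrightarrow> B k \<in> carrier_mat (card (\<pi> k)) (card (\<pi> k))"
  shows "diag_block_mat (map B [1..<Suc K]) \<in>
    carrier_mat (block_offset \<pi> (Suc K)) (block_offset \<pi> (Suc K))"
  using assms
proof (induction K)
  case 0
  show ?case by (simp add: block_offset_def)
next
  case (Suc K)
  then have "diag_block_mat (map B [1..<Suc K]) \<in>
      carrier_mat (block_offset \<pi> (Suc K)) (block_offset \<pi> (Suc K))"
    and "B (Suc K) \<in> carrier_mat (card (\<pi> (Suc K))) (card (\<pi> (Suc K)))"
    by auto
  then show ?case
    unfolding diag_block_mat_upt_Suc Let_def block_offset_Suc[of "Suc K", simplified]
    by (intro four_block_carrier_mat)
qed

lemma diag_block_mat_blocks_index: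
  fixes B :: "nat \<Rightarrow> 'b :: zero mat"
  assumes "\<And>k. k \<in> {1..K} \<Longrightarrow> B k \<in> carrier_mat (card (\<pi> k)) (card (\<pi> k))"
    and "k \<in> {1..K}" "i < card (\<pi> k)" "l \<in> {1..K}" "j < card (\<pi> l)"
  shows "diag_block_mat (map B [1..<Suc K]) $$ (block_offset \<pi> k + i, block_offset \<pi> l + j) =
    (if k = l then B k $$ (i, j) else 0)"
  using assms
proof (induction K)
  case 0
  then show ?case by simp
next
  case (Suc K)
  let ?D = "diag_block_mat (map B [1..<Suc K])" and ?C = "B (Suc K)"
  have D: "?D \<in> carrier_mat (block_offset \<pi> (Suc K)) (block_offset \<pi> (Suc K))"
    by (rule dim_diag_block_mat_blocks) (use Suc.prems(1) in auto)
  have C: "?C \<in> carrier_mat (card (\<pi> (Suc K))) (card (\<pi> (Suc K)))"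
    using Suc.prems(1) by auto
  have eq: "diag_block_mat (map B [1..<Suc (Suc K)]) =
      four_block_mat ?D (0\<^sub>m (dim_row ?D) (dim_col ?C)) (0\<^sub>m (dim_row ?C) (dim_col ?D)) ?C"
    by (simp only: diag_block_mat_upt_Suc Let_def)
  \<comment> \<open>Positions of earlier blocks fall inside the upper left matrix \<open>?D\<close>,
    while those of block \<open>Suc K\<close> start exactly at its dimension.\<close>
  have less: "block_offset \<pi> m + t < block_offset \<pi> (Suc K)"
    if "m \<in> {1..Suc K}" "m \<noteq> Suc K" "t < card (\<pi> m)" for m t
    using that by (intro block_index_less) auto
  have IH: "?D $$ (block_offset \<pi> k + i, block_offset \<pi> l + j) = (if k = l then B k $$ (i, j) else 0)"
    if "k \<noteq> Suc K" "l \<noteq> Suc K"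
    using that Suc.prems by (intro Suc.IH) auto
  \<comment> \<open>The cases are the four quadrants of \<open>four_block_mat\<close>; only the
    upper left one needs the induction hypothesis.\<close>
  consider "k = Suc K" "l = Suc K" | "k = Suc K" "l \<noteq> Suc K"
    | "k \<noteq> Suc K" "l = Suc K" | "k \<noteq> Suc K" "l \<noteq> Suc K" by blast
  then show ?case
  proof cases
    case 1
    then show ?thesis using Suc.prems(2-) C D unfolding eq by (simp del: upt_Suc One_nat_def)
  next
    case 2
    then show ?thesis using Suc.prems(2-) C D less[of l j] unfolding eq by (simp del: upt_Suc One_nat_def)
  next
    case 3
    then show ?thesis using Suc.prems(2-) C D less[of k i] unfolding eq by (simp del: upt_Suc One_nat_def)
  next
    case 4
    then show ?thesis using Suc.prems(2-) C D less[of l j] less[of k i] IH unfolding eq by (simp del: upt_Suc One_nat_def)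
  qed
qed

text \<open>A column through block \<open>k\<close> vanishes on the rows of every other block. The
  form with columns serves both factors of J^T H J, since a row of J^T is a column of J.\<close>

lemma sum_diag_block_mat_col:
  fixes B :: "nat \<Rightarrow> 'b :: semiring_0 mat"
  assumes B: "\<And>k. k \<in> {1..K} \<Longrightarrow> B k \<in> carrier_mat (card (\<pi> k)) (card (\<pi> k))"
    and k: "k \<in> {1..K}" and i: "i < card (\<pi> k)"
  shows "(\<Sum>s<block_offset \<pi> (Suc K).
      diag_block_mat (map B [1..<Suc K]) $$ (s, block_offset \<pi> k + i) * g s) =
    (\<Sum>s<card (\<pi> k). B k $$ (s, i) * g (block_offset \<pi> k + s))"
proof -
  have index: "diag_block_mat (map B [1..<Suc K]) $$ (block_offset \<pi> l + s, block_offset \<pi> k + i) =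
      (if l = k then B k $$ (s, i) else 0)" if "l \<in> {1..K}" "s < card (\<pi> l)" for l s
    using diag_block_mat_blocks_index[where B = B, OF B that k i] by simp
  have "(\<Sum>s<block_offset \<pi> (Suc K).
      diag_block_mat (map B [1..<Suc K]) $$ (s, block_offset \<pi> k + i) * g s) =
    (\<Sum>l\<in>{1..K}. if l = k
      then \<Sum>s<card (\<pi> k). B k $$ (s, i) * g (block_offset \<pi> k + s) else 0)"
    unfolding sum_over_blocks
    by (intro sum.cong refl) (simp add: index del: upt_Suc One_nat_def)
  then show ?thesis using k by simp
qed

section \<open>Entries of the Jacobian, of its derivative and of the dependent Hessian\<close>

lemma jac_block_carrier [simp]:
  "jac_block M Z r ps x \<in> carrier_mat (length ps) (length ps)"
  by (rule carrier_matI) (simp_all add: jac_block_def)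

lemma dep_deriv_jac_block_carrier [simp]:
  "dep_deriv_jac_block M Z r ps q x \<in> carrier_mat (length ps) (length ps)"
  by (rule carrier_matI) (simp_all add: dep_deriv_jac_block_def)

lemma hessian_carrier [simp]: "hessian f ps qs x \<in> carrier_mat (length ps) (length qs)"
  by (simp add: hessian_def)

lemma dim_jac_col [simp]: "dim_vec (jac_col M Z r ps p x) = length ps"
  by (simp add: jac_col_def Let_def)

lemma dim_deriv_jac_col [simp]: "dim_vec (deriv_jac_col M Z r ps p x) = length ps"
  by (simp add: deriv_jac_col_def Let_def)

lemma dim_gradient [simp]: "dim_vec (gradient f ps x) = length ps"
  by (simp add: gradient_def)

lemma gradient_index: "i < length ps \<Longrightarrow> gradient f ps x $ i = partial_deriv f (ps ! i) x"
  by (simp add: gradient_def vec_of_list_index del: vec_of_list_map)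

lemma DJ_block_carrier [simp]: "DJ_block M Z r f ps x \<in> carrier_mat (length ps) (length ps)"
  unfolding DJ_block_def Let_def by (rule mult_carrier_mat[where n = "length ps"]) simp_all

text \<open>By the chain rule, column \<open>i\<close> of the Jacobian has derivative J_ij times its
  second-derivative vector. The factor J_ij does not depend on \<open>s\<close> and leaves the sum;
  what remains is the diagonal weight that scales row \<open>i\<close>.\<close>

lemma DJ_block_index:
  assumes "i < length ps" and "j < length ps"
  shows "DJ_block M Z r f ps x $$ (i, j) =
    (\<Sum>s<length ps. dep_deriv_jac_block M Z r ps (ps ! j) x $$ (s, i) * gradient f ps x $ s)"
proof -
  have "DJ_block M Z r f ps x $$ (i, j) =
      (\<Sum>s<length ps. deriv_jac_col M Z r ps (ps ! i) x $ s * gradient f ps x $ s) *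
      jac_col M Z r ps (ps ! j) x $ i"
    using assms
    unfolding DJ_block_def Let_def mat_diag_mult_left[OF jac_block_carrier]
    by (simp add: jac_block_def mat_of_cols_index scalar_prod_def lessThan_atLeast0)
  also have "\<dots> =
      (\<Sum>s<length ps. dep_deriv_jac_block M Z r ps (ps ! j) x $$ (s, i) * gradient f ps x $ s)"
    using assms
    by (simp add: dep_deriv_jac_block_def mat_of_cols_index sum_distrib_left mult_ac)
  finally show ?thesis .
qed

text \<open>One formula serves every kind of block once block 1 receives the identity as Jacobian
  and zero as derivative. The matrix product comes from differentiating the gradient, the sum from
  differentiating the Jacobian.\<close>

lemma dep_hessian_block_index:
  fixes M :: "'a measure" and Z :: "nat \<Rightarrow> 'a \<Rightarrow> nat \<Rightarrow> real" and x :: "nat \<Rightarrow> real"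
    and r :: "nat \<Rightarrow> real \<Rightarrow> (nat \<Rightarrow> real) \<Rightarrow> nat \<Rightarrow> real"
  assumes kl: "k \<in> {1..K}" "l \<in> {1..K}" and ij: "i < card (\<pi> k)" "j < card (\<pi> l)"
  defines "B \<equiv> \<lambda>m. if m = 1 then 1\<^sub>m (card (\<pi> 1)) else jac_block M Z r (block_coords \<pi> m) x"
    and "D \<equiv> \<lambda>m. if m = 1 then 0\<^sub>m (card (\<pi> 1)) (card (\<pi> 1))
      else dep_deriv_jac_block M Z r (block_coords \<pi> m) (block_coords \<pi> l ! j) x"
  shows "dep_hessian M K \<pi> Z r f x $$ (block_offset \<pi> k + i, block_offset \<pi> l + j) =
    (transpose_mat (B k) * hessian f (block_coords \<pi> k) (block_coords \<pi> l) x * B l) $$ (i, j) +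
    (\<Sum>s<card (\<pi> k). D k $$ (s, i) * gradient f (block_coords \<pi> k) x $ s)"
proof -
  let ?N = "block_offset \<pi> (Suc K)" and ?cs = "all_coords K \<pi>"
  let ?H = "hessian f (block_coords \<pi> k) (block_coords \<pi> l) x"
  let ?a = "block_offset \<pi> k + i" and ?b = "block_offset \<pi> l + j"
  have K: "1 \<le> K" using kl by auto
  have B: "B m \<in> carrier_mat (card (\<pi> m)) (card (\<pi> m))" for m
    using jac_block_carrier[of M Z r "block_coords \<pi> m" x] by (auto simp: B_def)
  have D: "D m \<in> carrier_mat (card (\<pi> m)) (card (\<pi> m))" for m
    using dep_deriv_jac_block_carrier[of M Z r "block_coords \<pi> m" "block_coords \<pi> l ! j" x]
    by (auto simp: D_def)
  have H: "?H \<in> carrier_mat (card (\<pi> k)) (card (\<pi> l))"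
    using hessian_carrier[of f "block_coords \<pi> k" "block_coords \<pi> l" x] by simp
  have jac: "jac M K \<pi> Z r x = diag_block_mat (map B [1..<Suc K])"
    unfolding jac_def B_def by (rule diag_block_mat_upt_first[OF K])
  \<comment> \<open>\<open>dep_hessian\<close> finds the variable of differentiation at position
    \<open>?b\<close> of the full list, \<open>D\<close> names it inside block \<open>l\<close>;
    \<open>all_coords_nth\<close> identifies the two labels.\<close>
  have djac: "dep_deriv_jac M K \<pi> Z r (?cs ! ?b) x = diag_block_mat (map D [1..<Suc K])"
    unfolding dep_deriv_jac_def D_def all_coords_nth[of l K j \<pi>, OF kl(2) ij(2)]
    by (rule diag_block_mat_upt_first[OF K])
  have less: "block_offset \<pi> k + s < ?N" if "s < card (\<pi> k)" for s
    using kl that by (intro block_index_less)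
  have less': "block_offset \<pi> l + s < ?N" if "s < card (\<pi> l)" for s
    using kl that by (intro block_index_less)
  have grad: "gradient f ?cs x $ (block_offset \<pi> k + s) = gradient f (block_coords \<pi> k) x $ s"
    if "s < card (\<pi> k)" for s
    using kl less that by (simp add: gradient_index all_coords_nth)
  have hess: "hessian f ?cs ?cs x $$ (block_offset \<pi> k + s, block_offset \<pi> l + u) = ?H $$ (s, u)"
    if "s < card (\<pi> k)" "u < card (\<pi> l)" for s u
    using kl less less' that by (simp add: hessian_def all_coords_nth)
  have deriv_grad: "dep_deriv_gradient M K \<pi> Z r f ?b x $ (block_offset \<pi> k + s) = (?H * B l) $$ (s, j)"
    if s: "s < card (\<pi> k)" for s
  proof -
    \<comment> \<open>Column \<open>?b\<close> of the Jacobian lies in block \<open>l\<close>, so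
      only second derivatives with respect to labels of that block survive. The factors are swapped
      to put this column first.\<close>
    have "dep_deriv_gradient M K \<pi> Z r f ?b x $ (block_offset \<pi> k + s) =
        (\<Sum>u<?N. jac M K \<pi> Z r x $$ (u, ?b) * hessian f ?cs ?cs x $$ (block_offset \<pi> k + s, u))"
      using less[OF s] by (simp add: dep_deriv_gradient_def Let_def mult.commute)
    also have "\<dots> = (\<Sum>u<card (\<pi> l). B l $$ (u, j) * ?H $$ (s, u))"
      unfolding jac sum_diag_block_mat_col[where \<pi> = \<pi>, OF B kl(2) ij(2)] using s by (simp add: hess)
    also have "\<dots> = (?H * B l) $$ (s, j)"
      using s ij H B[of l] by (simp add: scalar_prod_def lessThan_atLeast0 mult.commute)
    finally show ?thesis .
  qed
  have "dep_hessian M K \<pi> Z r f x $$ (?a, ?b) =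
      (\<Sum>s<?N. dep_deriv_jac M K \<pi> Z r (?cs ! ?b) x $$ (s, ?a) * gradient f ?cs x $ s) +
      (\<Sum>s<?N. jac M K \<pi> Z r x $$ (s, ?a) * dep_deriv_gradient M K \<pi> Z r f ?b x $ s)"
    using less[OF ij(1)] less'[OF ij(2)] by (simp add: dep_hessian_def Let_def sum.distrib)
  \<comment> \<open>Column \<open>?a\<close> lies in block \<open>k\<close>, which restricts both
    sums to that block.\<close>
  also have "\<dots> = (\<Sum>s<card (\<pi> k). D k $$ (s, i) * gradient f (block_coords \<pi> k) x $ s) +
      (\<Sum>s<card (\<pi> k). B k $$ (s, i) * (?H * B l) $$ (s, j))"
    unfolding djac jac sum_diag_block_mat_col[where \<pi> = \<pi>, OF B kl(1) ij(1)]
      sum_diag_block_mat_col[where \<pi> = \<pi>, OF D kl(1) ij(1)]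
    by (simp add: grad deriv_grad)
  also have "(\<Sum>s<card (\<pi> k). B k $$ (s, i) * (?H * B l) $$ (s, j)) =
      (transpose_mat (B k) * (?H * B l)) $$ (i, j)"
    using ij H B[of k] B[of l] by (simp add: scalar_prod_def[of "col _ _"] lessThan_atLeast0)
  also have "transpose_mat (B k) * (?H * B l) = transpose_mat (B k) * ?H * B l"
    using H B[of k] B[of l] by (intro assoc_mult_mat[symmetric]) auto
  finally show ?thesis by (simp add: add.commute)
qed

section \<open>The dependent Hessian block by block\<close>

theorem theorem4:
  fixes M :: "'a measure" and d K :: nat and \<pi> :: "nat \<Rightarrow> nat set"
    and X :: "'a \<Rightarrow> nat \<Rightarrow> real" and Z :: "nat \<Rightarrow> 'a \<Rightarrow> nat \<Rightarrow> real"
    and r :: "nat \<Rightarrow> real \<Rightarrow> (nat \<Rightarrow> real) \<Rightarrow> nat \<Rightarrow> real"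
    and f :: "(nat \<Rightarrow> real) \<Rightarrow> real" and x :: "nat \<Rightarrow> real"
  assumes model: "dependency_model M d K \<pi> X Z r"
    and sample: "x \<in> X ` space M"
    and A2_joint_cdf:
      "continuous_map (product_topology (\<lambda>_. euclideanreal) {1..d}) euclideanreal (joint_cdf M d X)"
    and A2_joint_density:
      "positive_density_on_open_support (product_topology (\<lambda>_. euclideanreal) {1..d})
         (\<Pi>\<^sub>M i\<in>{1..d}. lborel) M X"
    and A2_marginal_cdf:
      "\<forall>i\<in>{1..d}. continuous_on UNIV (cdf (distr M borel (\<lambda>\<omega>. X \<omega> i)))"
    and A2_marginal_density:
      "\<forall>i\<in>{1..d}. positive_density_on_open_support euclideanreal lborel M (\<lambda>\<omega>. X \<omega> i)"
    and A5: "twice_partially_differentiable d f"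
    and A6:
      "\<forall>k\<in>{2..K}. \<forall>p\<in>\<pi> k. \<forall>j\<in>\<pi> k - {p}. \<forall>t\<in>(\<lambda>\<omega>. X \<omega> p) ` space M. \<forall>z\<in>Z p ` space M.
         twice_differentiable_at (\<lambda>s. r p s z j) t"
  defines "H \<equiv> \<lambda>k1 k2. hessian f (block_coords \<pi> k1) (block_coords \<pi> k2) x"
    and "J \<equiv> \<lambda>k. jac_block M Z r (block_coords \<pi> k) x"
    and "DJ \<equiv> \<lambda>k. DJ_block M Z r f (block_coords \<pi> k) x"
  shows "dep_hessian M K \<pi> Z r f x \<in> carrier_mat d d \<and>
    (\<forall>k1\<in>{1..K}. \<forall>k2\<in>{1..K}.
       mat_block \<pi> (dep_hessian M K \<pi> Z r f x) k1 k2 =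
         (if k1 = 1 \<and> k2 = 1 then H 1 1
          else if k1 = 1 then H 1 k2 * J k2
          else if k2 = 1 then transpose_mat (J k1) * H k1 1
          else if k1 \<noteq> k2 then transpose_mat (J k1) * H k1 k2 * J k2
          else transpose_mat (J k1) * H k1 k1 * J k1 + DJ k1))"
proof -
  interpret dependency_model M d K \<pi> X Z r by (fact model)
  have fin: "finite (\<pi> k)" if "k \<in> {1..K}" for k
    using blocks_cover that by (metis UN_upper finite_atLeastAtMost finite_subset)
  \<comment> \<open>Since the blocks partition the labels, the total offset is
    \<open>d\<close>.\<close>
  have "(\<Sum>k\<in>{1..K}. card (\<pi> k)) = card (\<Union>k\<in>{1..K}. \<pi> k)"
    using fin blocks_disjoint
    by (intro card_UN_disjoint[symmetric]) (auto simp: disjoint_family_on_def)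
  then have N: "block_offset \<pi> (Suc K) = d"
    unfolding block_offset_def blocks_cover by (simp add: atLeastLessThanSuc_atLeastAtMost)
  have mem: "block_coords \<pi> k ! i \<in> \<pi> k" if "k \<in> {1..K}" "i < card (\<pi> k)" for k i
    using that fin nth_mem[of i "block_coords \<pi> k"] by (simp add: block_coords_def)
  have set_coords: "set (block_coords \<pi> k) = \<pi> k" if "k \<in> {1..K}" for k
    using fin[OF that] by (simp add: block_coords_def)
  define B where "B m = (if m = 1 then 1\<^sub>m (card (\<pi> 1)) else J m)" for m
  have H: "H k l \<in> carrier_mat (card (\<pi> k)) (card (\<pi> l))" for k l
    unfolding H_def using hessian_carrier[of f "block_coords \<pi> k" "block_coords \<pi> l" x] by simp
  have J: "J k \<in> carrier_mat (card (\<pi> k)) (card (\<pi> k))" for k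
    unfolding J_def using jac_block_carrier[of M Z r "block_coords \<pi> k" x] by simp
  have DJ: "DJ k \<in> carrier_mat (card (\<pi> k)) (card (\<pi> k))" for k
    unfolding DJ_def using DJ_block_carrier[of M Z r f "block_coords \<pi> k" x] by simp
  have B: "B k \<in> carrier_mat (card (\<pi> k)) (card (\<pi> k))" for k
    using J[of k] by (auto simp: B_def)
  \<comment> \<open>\<open>E\<close> collects the contribution of the derivative of the Jacobian,
    which can be nonzero only on diagonal blocks other than the first.\<close>
  define E where "E k l = (if k = l \<and> k \<noteq> 1 then DJ k else 0\<^sub>m (card (\<pi> k)) (card (\<pi> l)))" for k l
  have E: "E k l \<in> carrier_mat (card (\<pi> k)) (card (\<pi> l))" for k l
    using DJ[of k] by (auto simp: E_def)
  have block: "mat_block \<pi> (dep_hessian M K \<pi> Z r f x) k l =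
      transpose_mat (B k) * H k l * B l + E k l"
    if kl: "k \<in> {1..K}" "l \<in> {1..K}" for k l
  proof (rule eq_matI)
    fix i j
    assume "i < dim_row (transpose_mat (B k) * H k l * B l + E k l)"
      and "j < dim_col (transpose_mat (B k) * H k l * B l + E k l)"
    then have ij: "i < card (\<pi> k)" "j < card (\<pi> l)" using E[of k l] by auto
    let ?q = "block_coords \<pi> l ! j"
    \<comment> \<open>For a variable of another block, the membership test in
      \<open>dep_deriv_jac_block\<close> fails and the derivative is zero.\<close>
    have notin: "?q \<notin> \<pi> k" if "k \<noteq> l"
      using that blocks_disjoint kl mem[OF kl(2) ij(2)] unfolding disjoint_family_on_def by blast
    \<comment> \<open>For \<open>k = 1\<close> the Jacobian is constant, for
      \<open>k \<noteq> l\<close> the label \<open>?q\<close> is foreign to block \<open>k\<close>,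
      and otherwise \<open>DJ_block_index\<close> evaluates the sum.\<close>
    have sum: "(\<Sum>s<card (\<pi> k). (if k = 1 then 0\<^sub>m (card (\<pi> 1)) (card (\<pi> 1))
        else dep_deriv_jac_block M Z r (block_coords \<pi> k) ?q x) $$ (s, i) *
          gradient f (block_coords \<pi> k) x $ s) = E k l $$ (i, j)"
      using ij notin set_coords[OF kl(1)] DJ_block_index[of i "block_coords \<pi> k" j M Z r f x]
      by (auto simp: E_def DJ_def dep_deriv_jac_block_def)
    have "mat_block \<pi> (dep_hessian M K \<pi> Z r f x) k l $$ (i, j) =
        dep_hessian M K \<pi> Z r f x $$ (block_offset \<pi> k + i, block_offset \<pi> l + j)"
      using ij by (simp add: mat_block_def)
    also have "\<dots> = (transpose_mat (B k) * H k l * B l) $$ (i, j) + E k l $$ (i, j)"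
      unfolding dep_hessian_block_index[where \<pi> = \<pi>, OF kl ij] sum H_def B_def J_def ..
    also have "\<dots> = (transpose_mat (B k) * H k l * B l + E k l) $$ (i, j)"
      using ij E[of k l] by simp
    finally show "mat_block \<pi> (dep_hessian M K \<pi> Z r f x) k l $$ (i, j) =
        (transpose_mat (B k) * H k l * B l + E k l) $$ (i, j)" .
  qed (use B[of k] B[of l] H[of k l] E[of k l] in \<open>auto simp: mat_block_def\<close>)
  have "dep_hessian M K \<pi> Z r f x \<in> carrier_mat d d"
    by (simp add: dep_hessian_def Let_def N)
  \<comment> \<open>The five cases follow from the uniform formula by cancelling identity factors in
    \<open>B\<close> and zero summands in \<open>E\<close>.\<close>
  moreover have "mat_block \<pi> (dep_hessian M K \<pi> Z r f x) k l =
         (if k = 1 \<and> l = 1 then H 1 1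
          else if k = 1 then H 1 l * J l
          else if l = 1 then transpose_mat (J k) * H k 1
          else if k \<noteq> l then transpose_mat (J k) * H k l * J l
          else transpose_mat (J k) * H k k * J k + DJ k)"
    if kl: "k \<in> {1..K}" "l \<in> {1..K}" for k l
    unfolding block[OF kl] using H[of k l] J[of k] J[of l]
    by (auto simp: B_def E_def)
  ultimately show ?thesis by blast
qed

end
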